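(* Let $\mathbf{\Phi}\in\mathbb{R}^{M\times N}$ and $\mathbf{\Psi}\in\mathbb{R}^{N\times M}$ be the BM3D analysis and synthesis matrices built from a grouping $J=\{J_r: r=1,\dots,R\}$, transforms $\mathbf{D}_1,\mathbf{D}_2$ and group weights $g_r>0$ (as defined in the context). Then $$\mathbf{\Phi}^{T}\mathbf{\Phi}=\sum_{r=1}^R\sum_{j\in J_{r}}\mathbf{P}_{j}^{T}\mathbf{P}_{j}>0,$$ $$\mathbf{\Psi}\mathbf{\Psi}^{T}=\Big(\sum_{r=1}^R g_{r}^{2}\sum_{j\in J_{r}}\mathbf{P}_{j}^{T}\mathbf{P}_{j}\Big)\mathbf{W}^{-2}>0,$$ $$\mathbf{\Psi}\mathbf{\Phi}=\mathbf{I}_{N\times N},$$ where $>0$ means positive definite.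
   Context: Images are $\sqrt N\times\sqrt N$ real matrices $\mathbf{Y}$, vectorized columnwise to $\mathbf{y}\in\mathbb{R}^N$. Each $\sqrt{N_{bl}}\times\sqrt{N_{bl}}$ square image block is indexed by the index $j$ (in $\mathbf{y}$) of its upper-left pixel. $\mathbf{P}_j$ is the $N_{bl}\times N$ zero-one selection matrix such that $\mathbf{y}_j=\mathbf{P}_j\mathbf{y}$ is the columnwise vectorization of the $j$-th block. Grouping: $J_r=\{j_{r,1},\dots,j_{r,K}\}$, $r=1,\dots,R$, are sets of $K$ (distinct) block indices. It is assumed that every pixel is contained in at least one block belonging to some group. Transforms: $\mathbf{D}_2$ is a $\sqrt{N_{bl}}\times\sqrt{N_{bl}}$ real orthogonal matrix (intrablock transform) and $\mathbf{D}_1$ is a $K\times K$ real orthogonal matrix (interblock transform). For $j=j_{r,k}\in J_r$, $\mathbf{d}_j$ denotes (within group $r$) the $k$-th column of $\mathbf{D}_1$. $\otimes$ is the Kronecker product. Analysis matrix: $\mathbf{\Phi}_r=\sum_{j\in J_r}\mathbf{d}_j\otimes[(\mathbf{D}_2\otimes\mathbf{D}_2)\mathbf{P}_j]$, of size $KN_{bl}\times N$, and $\mathbf{\Phi}=[\mathbf{\Phi}_1^T,\dots,\mathbf{\Phi}_R^T]^T$, of size $M\times N$ with $M=RKN_{bl}$. Synthesis matrix: $\mathbf{\Psi}_r=\sum_{j\in J_r}\mathbf{d}_j^T\otimes[\mathbf{P}_j^T(\mathbf{D}_2\otimes\mathbf{D}_2)^T]$, of size $N\times KN_{bl}$; given weights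 $g_r>0$, $\mathbf{W}=\sum_r g_r\sum_{j\in J_r}\mathbf{P}_j^T\mathbf{P}_j$ (a diagonal matrix) and $\mathbf{\Psi}=\mathbf{W}^{-1}[g_1\mathbf{\Psi}_1,\dots,g_R\mathbf{\Psi}_R]$. *)

theory Defs
  imports "Jordan_Normal_Form.Matrix"
begin

text \<open>
  Conventions. The image side is \<open>n\<close> (so that \<open>N = n * n\<close>) and the block side is \<open>b\<close> (so that
  \<open>N\<^sub>b\<^sub>l = b * b\<close>). All indices start at 0. Pixel \<open>(p, q)\<close> (row, column) of an image has index
  \<open>q * n + p\<close> in its columnwise vectorization.
\<close>

definition vec_of_mat :: "real mat \<Rightarrow> real vec" where
  "vec_of_mat Y = vec (dim_row Y * dim_col Y) (\<lambda>i. Y $$ (i mod dim_row Y, i div dim_row Y))"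

text \<open>The block with upper-left pixel \<open>j\<close> lies inside the image.\<close>

definition block_index :: "nat \<Rightarrow> nat \<Rightarrow> nat \<Rightarrow> bool" where
  "block_index n b j \<longleftrightarrow> j < n * n \<and> j mod n + b \<le> n \<and> j div n + b \<le> n"

definition image_block :: "nat \<Rightarrow> nat \<Rightarrow> nat \<Rightarrow> real mat \<Rightarrow> real mat" where
  "image_block n b j Y = mat b b (\<lambda>(p, q). Y $$ (j mod n + p, j div n + q))"

definition block_pixels :: "nat \<Rightarrow> nat \<Rightarrow> nat \<Rightarrow> nat set" where
  "block_pixels n b j = {(j div n + q) * n + (j mod n + p) | p q. p < b \<and> q < b}"

definition sel_mat :: "nat \<Rightarrow> nat \<Rightarrow> nat \<Rightarrow> real mat" where
  "sel_mat n b j = mat (b * b) (n * n)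
     (\<lambda>(s, i). if i = (j div n + s div b) * n + (j mod n + s mod b) then 1 else 0)"

definition kronecker :: "real mat \<Rightarrow> real mat \<Rightarrow> real mat" (infixr "\<otimes>\<^sub>m" 75) where
  "A \<otimes>\<^sub>m B = mat (dim_row A * dim_row B) (dim_col A * dim_col B)
     (\<lambda>(i, j). A $$ (i div dim_row B, j div dim_col B) * B $$ (i mod dim_row B, j mod dim_col B))"

text \<open>
  The type of matrices has no zero element, so \<open>sum\<close> does not apply. As for \<open>finsum_vec\<close>,
  we use the finite sum of the additive monoid of matrices of a given size.
\<close>

definition finsum_mat :: "nat \<Rightarrow> nat \<Rightarrow> ('i \<Rightarrow> real mat) \<Rightarrow> 'i set \<Rightarrow> real mat" where
  "finsum_mat nr nc = finsum (module_mat TYPE(real) nr nc)"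

text \<open>\<open>[A 0, \<dots>, A (R - 1)]\<close> for blocks \<open>A r\<close> of size \<open>nr \<times> w\<close>.\<close>

definition block_row :: "nat \<Rightarrow> nat \<Rightarrow> nat \<Rightarrow> (nat \<Rightarrow> real mat) \<Rightarrow> real mat" where
  "block_row nr w R A = mat nr (R * w) (\<lambda>(i, c). A (c div w) $$ (i, c mod w))"

text \<open>
  The predicate \<open>orthogonal_mat\<close> of the matrix library only asks for nonzero, pairwise orthogonal
  columns; here the columns are orthonormal.
\<close>

definition real_orthogonal :: "nat \<Rightarrow> real mat \<Rightarrow> bool" where
  "real_orthogonal m D \<longleftrightarrow> D \<in> carrier_mat m m \<and>
     transpose_mat D * D = 1\<^sub>m m \<and> D * transpose_mat D = 1\<^sub>m m"

definition pos_definite :: "nat \<Rightarrow> real mat \<Rightarrow> bool" where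
  "pos_definite m A \<longleftrightarrow> A \<in> carrier_mat m m \<and> transpose_mat A = A \<and>
     (\<forall>x \<in> carrier_vec m. x \<noteq> 0\<^sub>v m \<longrightarrow> 0 < x \<bullet> (A *\<^sub>v x))"

definition inv_mat :: "nat \<Rightarrow> real mat \<Rightarrow> real mat" where
  "inv_mat m A = inv\<^bsub>ring_mat TYPE(real) m ()\<^esub> A"

text \<open>
  A group of \<open>K\<close> block indices is given by an enumeration \<open>e\<close>, injective on \<open>{..<K}\<close>;
  a grouping is a family \<open>J\<close> of enumerations, with \<open>J r k\<close> the \<open>k\<close>-th block index of group \<open>r\<close>.
\<close>

definition group_set :: "nat \<Rightarrow> (nat \<Rightarrow> nat) \<Rightarrow> nat set" where
  "group_set K e = e ` {..<K}"

definition grouping :: "nat \<Rightarrow> nat \<Rightarrow> nat \<Rightarrow> nat \<Rightarrow> (nat \<Rightarrow> nat \<Rightarrow> nat) \<Rightarrow> bool" where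
  "grouping n b K R J \<longleftrightarrow>
     (\<forall>r<R. inj_on (J r) {..<K} \<and> (\<forall>j \<in> group_set K (J r). block_index n b j)) \<and>
     (\<forall>i < n * n. \<exists>r<R. \<exists>j \<in> group_set K (J r). i \<in> block_pixels n b j)"

text \<open>The vector \<open>d\<^sub>j\<close>, as a \<open>K \<times> 1\<close> matrix: column \<open>k\<close> of \<open>D1\<close> if \<open>j = e k\<close>.\<close>

definition inter_col :: "nat \<Rightarrow> real mat \<Rightarrow> (nat \<Rightarrow> nat) \<Rightarrow> nat \<Rightarrow> real mat" where
  "inter_col K D1 e j = mat_of_cols K [col D1 (the_inv_into {..<K} e j)]"

definition analysis_group ::
  "nat \<Rightarrow> nat \<Rightarrow> nat \<Rightarrow> real mat \<Rightarrow> real mat \<Rightarrow> (nat \<Rightarrow> nat) \<Rightarrow> real mat" where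
  "analysis_group n b K D1 D2 e = finsum_mat (K * (b * b)) (n * n)
     (\<lambda>j. inter_col K D1 e j \<otimes>\<^sub>m ((D2 \<otimes>\<^sub>m D2) * sel_mat n b j)) (group_set K e)"

definition analysis ::
  "nat \<Rightarrow> nat \<Rightarrow> nat \<Rightarrow> nat \<Rightarrow> real mat \<Rightarrow> real mat \<Rightarrow> (nat \<Rightarrow> nat \<Rightarrow> nat) \<Rightarrow> real mat" where
  "analysis n b K R D1 D2 J = transpose_mat
     (block_row (n * n) (K * (b * b)) R (\<lambda>r. transpose_mat (analysis_group n b K D1 D2 (J r))))"

definition synthesis_group ::
  "nat \<Rightarrow> nat \<Rightarrow> nat \<Rightarrow> real mat \<Rightarrow> real mat \<Rightarrow> (nat \<Rightarrow> nat) \<Rightarrow> real mat" where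
  "synthesis_group n b K D1 D2 e = finsum_mat (n * n) (K * (b * b))
     (\<lambda>j. transpose_mat (inter_col K D1 e j) \<otimes>\<^sub>m
          (transpose_mat (sel_mat n b j) * transpose_mat (D2 \<otimes>\<^sub>m D2)))
     (group_set K e)"

text \<open>The sum over \<open>j\<close> in one group of the products \<open>P\<^sub>j\<^sup>T P\<^sub>j\<close>.\<close>

definition group_gram :: "nat \<Rightarrow> nat \<Rightarrow> nat \<Rightarrow> (nat \<Rightarrow> nat) \<Rightarrow> real mat" where
  "group_gram n b K e = finsum_mat (n * n) (n * n)
     (\<lambda>j. transpose_mat (sel_mat n b j) * sel_mat n b j) (group_set K e)"

definition weight_mat ::
  "nat \<Rightarrow> nat \<Rightarrow> nat \<Rightarrow> nat \<Rightarrow> (nat \<Rightarrow> nat \<Rightarrow> nat) \<Rightarrow> (nat \<Rightarrow> real) \<Rightarrow> real mat" where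
  "weight_mat n b K R J g = finsum_mat (n * n) (n * n) (\<lambda>r. g r \<cdot>\<^sub>m group_gram n b K (J r)) {..<R}"

definition synthesis ::
  "nat \<Rightarrow> nat \<Rightarrow> nat \<Rightarrow> nat \<Rightarrow> real mat \<Rightarrow> real mat \<Rightarrow> (nat \<Rightarrow> nat \<Rightarrow> nat) \<Rightarrow> (nat \<Rightarrow> real) \<Rightarrow> real mat"
  where
  "synthesis n b K R D1 D2 J g = inv_mat (n * n) (weight_mat n b K R J g) *
     block_row (n * n) (K * (b * b)) R (\<lambda>r. g r \<cdot>\<^sub>m synthesis_group n b K D1 D2 (J r))"


text \<open>The finite sum is entrywise, and the summands above have the intended sizes.\<close>

lemma finsum_mat_carrier:
  assumes "\<And>s. s \<in> S \<Longrightarrow> f s \<in> carrier_mat nr nc"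
  shows "finsum_mat nr nc f S \<in> carrier_mat nr nc"
proof -
  interpret abelian_group "module_mat TYPE(real) nr nc" by (rule abelian_group_mat)
  have "finsum (module_mat TYPE(real) nr nc) f S \<in> carrier (module_mat TYPE(real) nr nc)"
    by (rule finsum_closed) (use assms in \<open>auto simp: module_mat_simps\<close>)
  then show ?thesis by (simp add: finsum_mat_def module_mat_simps)
qed

lemma index_finsum_mat:
  assumes "finite S" "\<And>s. s \<in> S \<Longrightarrow> f s \<in> carrier_mat nr nc" "i < nr" "j < nc"
  shows "finsum_mat nr nc f S $$ (i, j) = (\<Sum>s\<in>S. f s $$ (i, j))"
  using assms(1,2)
proof (induction S)
  case empty
  interpret abelian_group "module_mat TYPE(real) nr nc" by (rule abelian_group_mat)
  show ?case using assms(3,4) by (simp add: finsum_mat_def module_mat_simps)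
next
  case (insert s S)
  interpret abelian_group "module_mat TYPE(real) nr nc" by (rule abelian_group_mat)
  have "finsum_mat nr nc f (insert s S) = f s + finsum_mat nr nc f S"
    unfolding finsum_mat_def using insert
    by (subst finsum_insert) (auto simp: module_mat_simps)
  moreover have "finsum_mat nr nc f S \<in> carrier_mat nr nc"
    by (rule finsum_mat_carrier) (use insert in auto)
  ultimately show ?case using insert assms(3,4) by auto
qed

lemma sel_mat_carrier: "sel_mat n b j \<in> carrier_mat (b * b) (n * n)"
  by (simp add: sel_mat_def)

lemma kronecker_carrier:
  "A \<in> carrier_mat m n \<Longrightarrow> B \<in> carrier_mat p q \<Longrightarrow> A \<otimes>\<^sub>m B \<in> carrier_mat (m * p) (n * q)"
  by (auto simp: kronecker_def)

lemma analysis_summand_carrier: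
  assumes "D2 \<in> carrier_mat b b"
  shows "inter_col K D1 e j \<otimes>\<^sub>m ((D2 \<otimes>\<^sub>m D2) * sel_mat n b j) \<in> carrier_mat (K * (b * b)) (n * n)"
proof -
  have "(D2 \<otimes>\<^sub>m D2) * sel_mat n b j \<in> carrier_mat (b * b) (n * n)"
    using kronecker_carrier[OF assms assms] sel_mat_carrier by (rule mult_carrier_mat)
  moreover have "inter_col K D1 e j \<in> carrier_mat K 1" by (simp add: inter_col_def carrier_matI)
  ultimately show ?thesis using kronecker_carrier[of _ K 1 _ "b * b" "n * n"] by simp
qed

lemma synthesis_summand_carrier:
  assumes "D2 \<in> carrier_mat b b"
  shows "transpose_mat (inter_col K D1 e j) \<otimes>\<^sub>m
      (transpose_mat (sel_mat n b j) * transpose_mat (D2 \<otimes>\<^sub>m D2)) \<in> carrier_mat (n * n) (K * (b * b))"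
proof -
  have "transpose_mat (sel_mat n b j) * transpose_mat (D2 \<otimes>\<^sub>m D2) \<in> carrier_mat (n * n) (b * b)"
    using kronecker_carrier[OF assms assms] sel_mat_carrier[of n b j]
    by (meson mult_carrier_mat transpose_carrier_mat)
  moreover have "transpose_mat (inter_col K D1 e j) \<in> carrier_mat 1 K"
    by (simp add: inter_col_def carrier_matI)
  ultimately show ?thesis using kronecker_carrier[of _ 1 K _ "n * n" "b * b"] by simp
qed

text \<open>\<open>sel_mat n b j\<close> extracts the vectorized block with upper-left pixel \<open>j\<close>.\<close>

lemma sel_mat_extracts_block:
  assumes Y: "Y \<in> carrier_mat n n" and j: "block_index n b j"
  shows "sel_mat n b j *\<^sub>v vec_of_mat Y = vec_of_mat (image_block n b j Y)"
proof (rule eq_vecI)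
  show "dim_vec (sel_mat n b j *\<^sub>v vec_of_mat Y) = dim_vec (vec_of_mat (image_block n b j Y))"
    by (simp add: sel_mat_def vec_of_mat_def image_block_def)
next
  fix s assume "s < dim_vec (vec_of_mat (image_block n b j Y))"
  then have s: "s < b * b" by (simp add: vec_of_mat_def image_block_def)
  then have b: "0 < b" by (cases b) auto
  have q: "s div b < b" using s b by (simp add: div_less_iff_less_mult)
  have p: "s mod b < b" using b by simp
  let ?p = "j mod n + s mod b" and ?q = "j div n + s div b"
  let ?i = "?q * n + ?p"
  have pn: "?p < n" and qn: "?q < n" using j p q unfolding block_index_def by linarith+
  have im: "?i mod n = ?p" using pn by simp
  have idv: "?i div n = ?q" using pn by (simp add: div_mult_self3)
  have "?i < ?q * n + n" using pn by simp
  also have "\<dots> = Suc ?q * n" by simp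
  also have "\<dots> \<le> n * n" by (rule mult_right_mono) (use qn in auto)
  finally have i: "?i < n * n" .
  have Yd: "dim_row Y = n" "dim_col Y = n" using Y by auto
  have "(sel_mat n b j *\<^sub>v vec_of_mat Y) $ s =
      (\<Sum>i = 0..<n * n. (if i = ?i then 1 else 0) * Y $$ (i mod n, i div n))"
    using s by (simp add: sel_mat_def vec_of_mat_def scalar_prod_def Yd)
  also have "\<dots> = (\<Sum>i = 0..<n * n. if i = ?i then Y $$ (i mod n, i div n) else 0)"
    by (rule sum.cong) auto
  also have "\<dots> = Y $$ (?p, ?q)"
    using i im idv by (subst sum.delta) auto
  also have "\<dots> = vec_of_mat (image_block n b j Y) $ s"
    using s p q by (simp add: vec_of_mat_def image_block_def)
  finally show "(sel_mat n b j *\<^sub>v vec_of_mat Y) $ s = vec_of_mat (image_block n b j Y) $ s" .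
qed

end

theory Submission
  imports Defs
begin

text \<open>
  Since \<open>d\<^sub>j\<^sup>T \<otimes> (P\<^sub>j\<^sup>T Q\<^sup>T) = (d\<^sub>j \<otimes> (Q P\<^sub>j))\<^sup>T\<close> for \<open>Q = D\<^sub>2 \<otimes> D\<^sub>2\<close>, we have \<open>\<Psi>\<^sub>r = \<Phi>\<^sub>r\<^sup>T\<close>. Orthonormality of
  the columns \<open>d\<^sub>j\<close> kills the cross terms of \<open>\<Phi>\<^sub>r\<^sup>T \<Phi>\<^sub>r\<close>, and orthogonality of \<open>Q\<close> leaves
  \<open>\<Phi>\<^sub>r\<^sup>T \<Phi>\<^sub>r = \<Sum>\<^sub>j P\<^sub>j\<^sup>T P\<^sub>j\<close>. This matrix is diagonal with nonnegative entries, so everything else is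
  a computation with diagonal matrices; the covering assumption makes the entries of their sums
  over \<open>r\<close> positive.
\<close>

subsection \<open>Finite sums and scalar multiples of matrices\<close>

lemma finsum_mat_cong:
  assumes "finite S" "\<And>s. s \<in> S \<Longrightarrow> f s = h s" "\<And>s. s \<in> S \<Longrightarrow> h s \<in> carrier_mat nr nc"
  shows "finsum_mat nr nc f S = finsum_mat nr nc h S"
proof (rule eq_matI)
  have c: "finsum_mat nr nc f S \<in> carrier_mat nr nc" "finsum_mat nr nc h S \<in> carrier_mat nr nc"
    by (rule finsum_mat_carrier; simp add: assms)+
  then show "dim_row (finsum_mat nr nc f S) = dim_row (finsum_mat nr nc h S)"
    "dim_col (finsum_mat nr nc f S) = dim_col (finsum_mat nr nc h S)" by auto
  fix i j assume "i < dim_row (finsum_mat nr nc h S)" "j < dim_col (finsum_mat nr nc h S)"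
  then show "finsum_mat nr nc f S $$ (i, j) = finsum_mat nr nc h S $$ (i, j)"
    using c by (simp add: index_finsum_mat assms)
qed

lemma transpose_finsum_mat:
  assumes "finite S" "\<And>s. s \<in> S \<Longrightarrow> f s \<in> carrier_mat nr nc"
  shows "transpose_mat (finsum_mat nr nc f S) = finsum_mat nc nr (\<lambda>s. transpose_mat (f s)) S"
proof (rule eq_matI)
  have c: "finsum_mat nr nc f S \<in> carrier_mat nr nc"
    "finsum_mat nc nr (\<lambda>s. transpose_mat (f s)) S \<in> carrier_mat nc nr"
    by (rule finsum_mat_carrier; simp add: assms)+
  then show "dim_row (transpose_mat (finsum_mat nr nc f S)) =
      dim_row (finsum_mat nc nr (\<lambda>s. transpose_mat (f s)) S)"
    "dim_col (transpose_mat (finsum_mat nr nc f S)) =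
      dim_col (finsum_mat nc nr (\<lambda>s. transpose_mat (f s)) S)" by auto
  fix i j assume "i < dim_row (finsum_mat nc nr (\<lambda>s. transpose_mat (f s)) S)"
    "j < dim_col (finsum_mat nc nr (\<lambda>s. transpose_mat (f s)) S)"
  then have ij: "i < nc" "j < nr" using c by auto
  have "transpose_mat (f s) $$ (i, j) = f s $$ (j, i)" if "s \<in> S" for s
    using ij assms(2)[OF that] by auto
  then show "transpose_mat (finsum_mat nr nc f S) $$ (i, j) =
      finsum_mat nc nr (\<lambda>s. transpose_mat (f s)) S $$ (i, j)"
    using c ij by (simp add: index_finsum_mat assms)
qed

lemma index_mult_mat_sum:
  assumes "A \<in> carrier_mat nr m" "B \<in> carrier_mat m nc" "i < nr" "j < nc"
  shows "(A * B) $$ (i, j) = (\<Sum>k<m. A $$ (i, k) * B $$ (k, j))"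
proof -
  have "(A * B) $$ (i, j) = (\<Sum>k = 0..<m. A $$ (i, k) * B $$ (k, j))"
    using assms by (auto simp: scalar_prod_def)
  then show ?thesis by (simp add: atLeast0LessThan)
qed

text \<open>The factors are rectangular, so the two sums live in additive groups of matrices of
  different sizes. Distributivity is therefore checked entry by entry, where it is an exchange of
  two finite sums.\<close>

lemma finsum_mat_mult_right:
  assumes "finite S" "\<And>s. s \<in> S \<Longrightarrow> f s \<in> carrier_mat nr m" "B \<in> carrier_mat m nc"
  shows "finsum_mat nr m f S * B = finsum_mat nr nc (\<lambda>s. f s * B) S"
proof (rule eq_matI)
  have c: "finsum_mat nr m f S \<in> carrier_mat nr m"
    by (rule finsum_mat_carrier) (simp add: assms)
  have p: "s \<in> S \<Longrightarrow> f s * B \<in> carrier_mat nr nc" for s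
    using assms by (meson mult_carrier_mat)
  then have d: "finsum_mat nr nc (\<lambda>s. f s * B) S \<in> carrier_mat nr nc"
    by (rule finsum_mat_carrier)
  show "dim_row (finsum_mat nr m f S * B) = dim_row (finsum_mat nr nc (\<lambda>s. f s * B) S)"
    "dim_col (finsum_mat nr m f S * B) = dim_col (finsum_mat nr nc (\<lambda>s. f s * B) S)"
    using c d assms(3) by auto
  fix i j assume "i < dim_row (finsum_mat nr nc (\<lambda>s. f s * B) S)"
    "j < dim_col (finsum_mat nr nc (\<lambda>s. f s * B) S)"
  then have ij: "i < nr" "j < nc" using d by auto
  have "(finsum_mat nr m f S * B) $$ (i, j) = (\<Sum>k<m. \<Sum>s\<in>S. f s $$ (i, k) * B $$ (k, j))"
    by (simp add: index_mult_mat_sum[OF c assms(3) ij] index_finsum_mat assms ij sum_distrib_right)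
  also have "\<dots> = (\<Sum>s\<in>S. \<Sum>k<m. f s $$ (i, k) * B $$ (k, j))"
    by (rule sum.swap)
  also have "\<dots> = (\<Sum>s\<in>S. (f s * B) $$ (i, j))"
    by (intro sum.cong refl index_mult_mat_sum[symmetric, OF _ assms(3) ij] assms(2))
  also have "\<dots> = finsum_mat nr nc (\<lambda>s. f s * B) S $$ (i, j)"
    by (rule index_finsum_mat[symmetric]) (use p ij assms in auto)
  finally show "(finsum_mat nr m f S * B) $$ (i, j) = finsum_mat nr nc (\<lambda>s. f s * B) S $$ (i, j)" .
qed

lemma finsum_mat_mult_left:
  assumes "finite S" "\<And>s. s \<in> S \<Longrightarrow> f s \<in> carrier_mat m nc" "A \<in> carrier_mat nr m"
  shows "A * finsum_mat m nc f S = finsum_mat nr nc (\<lambda>s. A * f s) S"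
proof (rule eq_matI)
  have c: "finsum_mat m nc f S \<in> carrier_mat m nc"
    by (rule finsum_mat_carrier) (simp add: assms)
  have p: "s \<in> S \<Longrightarrow> A * f s \<in> carrier_mat nr nc" for s
    using assms by (meson mult_carrier_mat)
  then have d: "finsum_mat nr nc (\<lambda>s. A * f s) S \<in> carrier_mat nr nc"
    by (rule finsum_mat_carrier)
  show "dim_row (A * finsum_mat m nc f S) = dim_row (finsum_mat nr nc (\<lambda>s. A * f s) S)"
    "dim_col (A * finsum_mat m nc f S) = dim_col (finsum_mat nr nc (\<lambda>s. A * f s) S)"
    using c d assms(3) by auto
  fix i j assume "i < dim_row (finsum_mat nr nc (\<lambda>s. A * f s) S)"
    "j < dim_col (finsum_mat nr nc (\<lambda>s. A * f s) S)"
  then have ij: "i < nr" "j < nc" using d by auto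
  have "(A * finsum_mat m nc f S) $$ (i, j) = (\<Sum>k<m. \<Sum>s\<in>S. A $$ (i, k) * f s $$ (k, j))"
    by (simp add: index_mult_mat_sum[OF assms(3) c ij] index_finsum_mat assms ij sum_distrib_left)
  also have "\<dots> = (\<Sum>s\<in>S. \<Sum>k<m. A $$ (i, k) * f s $$ (k, j))"
    by (rule sum.swap)
  also have "\<dots> = (\<Sum>s\<in>S. (A * f s) $$ (i, j))"
    by (intro sum.cong refl index_mult_mat_sum[symmetric, OF assms(3) _ ij] assms(2))
  also have "\<dots> = finsum_mat nr nc (\<lambda>s. A * f s) S $$ (i, j)"
    by (rule index_finsum_mat[symmetric]) (use p ij assms in auto)
  finally show "(A * finsum_mat m nc f S) $$ (i, j) = finsum_mat nr nc (\<lambda>s. A * f s) S $$ (i, j)" .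
qed

text \<open>Collapses a sum over a group once orthonormality has turned all cross terms into zero
  matrices.\<close>

lemma finsum_mat_delta:
  assumes "finite S" "s \<in> S" "f s \<in> carrier_mat nr nc"
  shows "finsum_mat nr nc (\<lambda>t. if s = t then f t else 0\<^sub>m nr nc) S = f s"
proof (rule eq_matI)
  have p: "(if s = t then f t else 0\<^sub>m nr nc) \<in> carrier_mat nr nc" for t
    using assms by auto
  then have c: "finsum_mat nr nc (\<lambda>t. if s = t then f t else 0\<^sub>m nr nc) S \<in> carrier_mat nr nc"
    by (intro finsum_mat_carrier)
  show "dim_row (finsum_mat nr nc (\<lambda>t. if s = t then f t else 0\<^sub>m nr nc) S) = dim_row (f s)"
    "dim_col (finsum_mat nr nc (\<lambda>t. if s = t then f t else 0\<^sub>m nr nc) S) = dim_col (f s)"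
    using c assms by auto
  fix i j assume "i < dim_row (f s)" "j < dim_col (f s)"
  then have ij: "i < nr" "j < nc" using assms by auto
  have "finsum_mat nr nc (\<lambda>t. if s = t then f t else 0\<^sub>m nr nc) S $$ (i, j)
      = (\<Sum>t\<in>S. (if s = t then f t else 0\<^sub>m nr nc) $$ (i, j))"
    by (rule index_finsum_mat[OF assms(1) p ij])
  also have "\<dots> = (\<Sum>t\<in>S. if s = t then f t $$ (i, j) else 0)"
    by (rule sum.cong) (use ij in auto)
  also have "\<dots> = f s $$ (i, j)" using assms by simp
  finally show "finsum_mat nr nc (\<lambda>t. if s = t then f t else 0\<^sub>m nr nc) S $$ (i, j) = f s $$ (i, j)" .
qed

text \<open>The passage from matrices to numbers: from here on a sum of Gram matrices is handled
  through its diagonal entries alone.\<close>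

lemma finsum_mat_diag:
  assumes "finite S"
  shows "finsum_mat m m (\<lambda>s. mat_diag m (f s)) S = mat_diag m (\<lambda>i. \<Sum>s\<in>S. f s i)"
proof (rule eq_matI)
  have c: "finsum_mat m m (\<lambda>s. mat_diag m (f s)) S \<in> carrier_mat m m"
    by (rule finsum_mat_carrier) simp
  show "dim_row (finsum_mat m m (\<lambda>s. mat_diag m (f s)) S) = dim_row (mat_diag m (\<lambda>i. \<Sum>s\<in>S. f s i))"
    "dim_col (finsum_mat m m (\<lambda>s. mat_diag m (f s)) S) = dim_col (mat_diag m (\<lambda>i. \<Sum>s\<in>S. f s i))"
    using c by (auto simp: mat_diag_def)
  fix i j assume "i < dim_row (mat_diag m (\<lambda>i. \<Sum>s\<in>S. f s i))"
    "j < dim_col (mat_diag m (\<lambda>i. \<Sum>s\<in>S. f s i))"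
  then have "i < m" "j < m" by (auto simp: mat_diag_def)
  then show "finsum_mat m m (\<lambda>s. mat_diag m (f s)) S $$ (i, j) =
      mat_diag m (\<lambda>i. \<Sum>s\<in>S. f s i) $$ (i, j)"
    by (simp add: index_finsum_mat[OF assms mat_diag_dim]) (simp add: mat_diag_def)
qed

lemma transpose_smult_mat: "transpose_mat (c \<cdot>\<^sub>m A) = c \<cdot>\<^sub>m transpose_mat A"
  by (rule eq_matI) auto

lemma smult_smult_mat: "c \<cdot>\<^sub>m (d \<cdot>\<^sub>m A) = (c * d :: real) \<cdot>\<^sub>m A"
  by (rule eq_matI) auto

lemma zero_smult_mat: "A \<in> carrier_mat nr nc \<Longrightarrow> (0 :: real) \<cdot>\<^sub>m A = 0\<^sub>m nr nc"
  by (rule eq_matI) auto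

lemma one_smult_mat: "(1 :: real) \<cdot>\<^sub>m A = A"
  by (rule eq_matI) auto

subsection \<open>Kronecker products and block rows\<close>

lemma less_mult_divmod:
  fixes c K B :: nat
  assumes "c < K * B"
  shows "c div B < K" "c mod B < B"
proof -
  have "0 < B" using assms by (cases B) auto
  then show "c div B < K" "c mod B < B" using assms by (auto simp: div_less_iff_less_mult)
qed

lemma mult_add_less_mult:
  fixes a s K B :: nat
  assumes "a < K" "s < B"
  shows "a * B + s < K * B"
proof -
  have "a * B + s < Suc a * B" using assms by simp
  also have "\<dots> \<le> K * B" using assms by (intro mult_right_mono) auto
  finally show ?thesis .
qed

text \<open>The pairs \<open>(a, s)\<close> and the indices \<open>a * B + s\<close> are in
  bijection, with quotient and remainder as inverse. Kronecker products and block rows both index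
  their columns this way, so this one reindexing serves both.\<close>

lemma sum_divmod:
  fixes f :: "nat \<Rightarrow> nat \<Rightarrow> 'a::comm_monoid_add"
  shows "(\<Sum>c<K * B. f (c div B) (c mod B)) = (\<Sum>a<K. \<Sum>s<B. f a s)"
proof -
  have "(\<Sum>c<K * B. f (c div B) (c mod B)) = (\<Sum>(a, s)\<in>{..<K} \<times> {..<B}. f a s)"
    by (rule sum.reindex_bij_witness[of _ "\<lambda>(a, s). a * B + s" "\<lambda>c. (c div B, c mod B)"])
      (auto simp: less_mult_divmod mult_add_less_mult)
  then show ?thesis by (simp add: sum.cartesian_product)
qed

lemma transpose_kronecker:
  "transpose_mat (A \<otimes>\<^sub>m B) = transpose_mat A \<otimes>\<^sub>m transpose_mat B"
  by (rule eq_matI) (auto simp: kronecker_def less_mult_divmod)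

lemma index_kronecker:
  assumes "A \<in> carrier_mat m n" "B \<in> carrier_mat p q" "i < m * p" "j < n * q"
  shows "(A \<otimes>\<^sub>m B) $$ (i, j) = A $$ (i div p, j div q) * B $$ (i mod p, j mod q)"
  using assms by (auto simp: kronecker_def)

text \<open>The mixed-product rule. Splitting the inner index into quotient and remainder separates
  the variables, and the resulting double sum factors into an entry of \<open>A * C\<close> times an
  entry of \<open>B * D\<close>.\<close>

lemma kronecker_mult:
  assumes A: "A \<in> carrier_mat m k" and B: "B \<in> carrier_mat p l"
    and C: "C \<in> carrier_mat k n" and D: "D \<in> carrier_mat l q"
  shows "(A \<otimes>\<^sub>m B) * (C \<otimes>\<^sub>m D) = (A * C) \<otimes>\<^sub>m (B * D)"
proof (rule eq_matI)
  have AB: "A \<otimes>\<^sub>m B \<in> carrier_mat (m * p) (k * l)" and CD: "C \<otimes>\<^sub>m D \<in> carrier_mat (k * l) (n * q)"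
    and AC: "A * C \<in> carrier_mat m n" and BD: "B * D \<in> carrier_mat p q"
    using assms by (auto intro: kronecker_carrier)
  have E: "(A * C) \<otimes>\<^sub>m (B * D) \<in> carrier_mat (m * p) (n * q)"
    using AC BD by (rule kronecker_carrier)
  show "dim_row ((A \<otimes>\<^sub>m B) * (C \<otimes>\<^sub>m D)) = dim_row ((A * C) \<otimes>\<^sub>m (B * D))"
    "dim_col ((A \<otimes>\<^sub>m B) * (C \<otimes>\<^sub>m D)) = dim_col ((A * C) \<otimes>\<^sub>m (B * D))"
    using AB CD E by auto
  fix i j assume "i < dim_row ((A * C) \<otimes>\<^sub>m (B * D))" "j < dim_col ((A * C) \<otimes>\<^sub>m (B * D))"
  then have ij: "i < m * p" "j < n * q" using E by auto
  have "((A \<otimes>\<^sub>m B) * (C \<otimes>\<^sub>m D)) $$ (i, j) = (\<Sum>c<k * l.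
      (A $$ (i div p, c div l) * C $$ (c div l, j div q)) *
      (B $$ (i mod p, c mod l) * D $$ (c mod l, j mod q)))"
    by (simp add: index_mult_mat_sum[OF AB CD ij] index_kronecker[OF A B ij(1)]
        index_kronecker[OF C D _ ij(2)] mult_ac)
  also have "\<dots> = (\<Sum>a<k. \<Sum>s<l. (A $$ (i div p, a) * C $$ (a, j div q)) *
      (B $$ (i mod p, s) * D $$ (s, j mod q)))"
    by (rule sum_divmod)
  also have "\<dots> = (A * C) $$ (i div p, j div q) * (B * D) $$ (i mod p, j mod q)"
    by (simp add: index_mult_mat_sum[OF A C] index_mult_mat_sum[OF B D] less_mult_divmod[OF ij(1)]
        less_mult_divmod[OF ij(2)] sum_product)
  also have "\<dots> = ((A * C) \<otimes>\<^sub>m (B * D)) $$ (i, j)"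
    by (rule index_kronecker[OF AC BD ij, symmetric])
  finally show "((A \<otimes>\<^sub>m B) * (C \<otimes>\<^sub>m D)) $$ (i, j) = ((A * C) \<otimes>\<^sub>m (B * D)) $$ (i, j)" .
qed

text \<open>Two indices are equal exactly when their quotients and their remainders agree, so the
  product of the two Kronecker deltas is again one.\<close>

lemma kronecker_one: "1\<^sub>m m \<otimes>\<^sub>m 1\<^sub>m p = 1\<^sub>m (m * p)"
proof (rule eq_matI)
  fix i j assume "i < dim_row (1\<^sub>m (m * p) :: real mat)" "j < dim_col (1\<^sub>m (m * p) :: real mat)"
  then have ij: "i < m * p" "j < m * p" by auto
  have "i = j \<longleftrightarrow> i div p = j div p \<and> i mod p = j mod p"
    by (metis div_mult_mod_eq)
  then show "(1\<^sub>m m \<otimes>\<^sub>m 1\<^sub>m p) $$ (i, j) = 1\<^sub>m (m * p) $$ (i, j)"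
    using ij less_mult_divmod[OF ij(1)] less_mult_divmod[OF ij(2)] by (auto simp: kronecker_def)
qed (auto simp: kronecker_def)

text \<open>Meant for the 1 x 1 product of a transposed column of \<open>D1\<close> with another
  column, which thereby becomes an ordinary scalar.\<close>

lemma kronecker_one_left:
  assumes "A \<in> carrier_mat 1 1"
  shows "A \<otimes>\<^sub>m B = A $$ (0, 0) \<cdot>\<^sub>m B"
  by (rule eq_matI) (use assms in \<open>auto simp: kronecker_def\<close>)

lemma block_row_carrier: "block_row nr w R A \<in> carrier_mat nr (R * w)"
  by (simp add: block_row_def)

text \<open>Column \<open>c\<close> of a block row belongs to block \<open>c div w\<close>, so the
  sum over \<open>c\<close> splits into one matrix product per block. The second factor is a
  transposed block row because \<open>analysis\<close> is defined as one; the same form also covers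
  the synthesis matrix times its transpose.\<close>

lemma block_row_mult_transpose:
  assumes A: "\<And>r. r < R \<Longrightarrow> A r \<in> carrier_mat m w" and C: "\<And>r. r < R \<Longrightarrow> C r \<in> carrier_mat n w"
  shows "block_row m w R A * transpose_mat (block_row n w R C) =
    finsum_mat m n (\<lambda>r. A r * transpose_mat (C r)) {..<R}"
proof (rule eq_matI)
  have p: "A r * transpose_mat (C r) \<in> carrier_mat m n" if "r \<in> {..<R}" for r
    using A[of r] C[of r] that by (intro mult_carrier_mat) auto
  then have c: "finsum_mat m n (\<lambda>r. A r * transpose_mat (C r)) {..<R} \<in> carrier_mat m n"
    by (rule finsum_mat_carrier)
  have T: "transpose_mat (block_row n w R C) \<in> carrier_mat (R * w) n"
    using block_row_carrier by simp
  show "dim_row (block_row m w R A * transpose_mat (block_row n w R C)) =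
      dim_row (finsum_mat m n (\<lambda>r. A r * transpose_mat (C r)) {..<R})"
    "dim_col (block_row m w R A * transpose_mat (block_row n w R C)) =
      dim_col (finsum_mat m n (\<lambda>r. A r * transpose_mat (C r)) {..<R})"
    using c by (auto simp: block_row_def)
  fix i j assume "i < dim_row (finsum_mat m n (\<lambda>r. A r * transpose_mat (C r)) {..<R})"
    "j < dim_col (finsum_mat m n (\<lambda>r. A r * transpose_mat (C r)) {..<R})"
  then have ij: "i < m" "j < n" using c by auto
  have e: "(A r * transpose_mat (C r)) $$ (i, j) = (\<Sum>s<w. A r $$ (i, s) * C r $$ (j, s))"
    if "r < R" for r
    using index_mult_mat_sum[OF A[OF that], of "transpose_mat (C r)" n i j] C[OF that] ij by auto
  have "(block_row m w R A * transpose_mat (block_row n w R C)) $$ (i, j) =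
      (\<Sum>c<R * w. A (c div w) $$ (i, c mod w) * C (c div w) $$ (j, c mod w))"
    unfolding index_mult_mat_sum[OF block_row_carrier T ij]
    by (rule sum.cong) (use ij in \<open>auto simp: block_row_def\<close>)
  also have "\<dots> = (\<Sum>r<R. \<Sum>s<w. A r $$ (i, s) * C r $$ (j, s))"
    by (rule sum_divmod)
  also have "\<dots> = (\<Sum>r<R. (A r * transpose_mat (C r)) $$ (i, j))"
    by (simp add: e)
  also have "\<dots> = finsum_mat m n (\<lambda>r. A r * transpose_mat (C r)) {..<R} $$ (i, j)"
    using index_finsum_mat[of "{..<R}", OF _ p ij] by simp
  finally show "(block_row m w R A * transpose_mat (block_row n w R C)) $$ (i, j) =
      finsum_mat m n (\<lambda>r. A r * transpose_mat (C r)) {..<R} $$ (i, j)" .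
qed

subsection \<open>Diagonal matrices\<close>

lemma mat_diag_cong: "(\<And>i. i < m \<Longrightarrow> f i = h i) \<Longrightarrow> mat_diag m f = mat_diag m h"
  by (rule eq_matI) (auto simp: mat_diag_def)

lemma smult_mat_diag: "c \<cdot>\<^sub>m mat_diag m f = mat_diag m (\<lambda>i. c * f i :: real)"
  by (rule eq_matI) (auto simp: mat_diag_def)

lemma transpose_mat_diag: "transpose_mat (mat_diag m f) = mat_diag m f"
  by (rule eq_matI) (auto simp: mat_diag_def)

text \<open>\<open>inv_mat\<close> is the inverse in the matrix ring, and inverses there are unique,
  so it suffices that the reciprocal diagonal is inverse on both sides.\<close>

lemma inv_mat_diag:
  assumes "\<And>i. i < m \<Longrightarrow> f i \<noteq> 0"
  shows "inv_mat m (mat_diag m f) = mat_diag m (\<lambda>i. 1 / f i)"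
proof -
  interpret ring "ring_mat TYPE(real) m ()" by (rule ring_mat)
  have "mat_diag m f * mat_diag m (\<lambda>i. 1 / f i) = 1\<^sub>m m"
    "mat_diag m (\<lambda>i. 1 / f i) * mat_diag m f = 1\<^sub>m m"
    unfolding mat_diag_diag mat_diag_one[symmetric]
    by (rule mat_diag_cong; simp add: assms)+
  then show ?thesis
    unfolding inv_mat_def by (intro inv_unique'[symmetric]) (auto simp: ring_mat_simps)
qed

text \<open>The quadratic form is the sum of the terms \<open>f k * (x $ k)\<^sup>2\<close>. None is
  negative, and a nonzero coordinate of \<open>x\<close> yields a positive one.\<close>

lemma pos_definite_mat_diag:
  assumes "\<And>i. i < m \<Longrightarrow> 0 < f i"
  shows "pos_definite m (mat_diag m f)"
  unfolding pos_definite_def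
proof (intro conjI ballI impI mat_diag_dim transpose_mat_diag)
  fix x :: "real vec" assume x: "x \<in> carrier_vec m" and "x \<noteq> 0\<^sub>v m"
  then obtain i where i: "i < m" "x $ i \<noteq> 0" by (metis carrier_vecD eq_vecI index_zero_vec)
  have "(mat_diag m f *\<^sub>v x) $ k = f k * x $ k" if "k < m" for k
  proof -
    have "(mat_diag m f *\<^sub>v x) $ k = (\<Sum>l = 0..<m. (if k = l then f l else 0) * x $ l)"
      using x that by (simp add: mat_diag_def scalar_prod_def)
    also have "\<dots> = (\<Sum>l = 0..<m. if k = l then f l * x $ l else 0)"
      by (rule sum.cong) auto
    also have "\<dots> = f k * x $ k" using that by simp
    finally show ?thesis .
  qed
  then have "x \<bullet> (mat_diag m f *\<^sub>v x) = (\<Sum>k = 0..<m. f k * (x $ k)\<^sup>2)"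
    using x by (auto simp: scalar_prod_def mat_diag_def power2_eq_square mult_ac intro!: sum.cong)
  also have "0 < \<dots>"
    by (rule sum_pos2[of _ i]) (use i assms in \<open>auto intro!: mult_nonneg_nonneg simp: less_imp_le\<close>)
  finally show "0 < x \<bullet> (mat_diag m f *\<^sub>v x)" .
qed

subsection \<open>One group\<close>

lemma inter_col_carrier: "inter_col K D1 e j \<in> carrier_mat K 1"
  by (simp add: inter_col_def carrier_matI)

text \<open>The product is an entry of \<open>transpose_mat D1 * D1\<close>, at the column positions
  that \<open>the_inv_into\<close> recovers from the block indices. Injectivity of \<open>e\<close>
  makes equality of positions the same as equality of block indices.\<close>

lemma inter_col_orthonormal:
  assumes D: "real_orthogonal K D1" and e: "inj_on e {..<K}"
    and jl: "j \<in> group_set K e" "l \<in> group_set K e"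
  shows "(transpose_mat (inter_col K D1 e j) * inter_col K D1 e l) $$ (0, 0) = (if j = l then 1 else 0)"
proof -
  obtain a c where a: "j = e a" "a < K" and c: "l = e c" "c < K"
    using jl by (auto simp: group_set_def)
  have D1: "D1 \<in> carrier_mat K K" and DD: "transpose_mat D1 * D1 = 1\<^sub>m K"
    using D by (auto simp: real_orthogonal_def)
  have ia: "the_inv_into {..<K} e j = a" and ic: "the_inv_into {..<K} e l = c"
    using a c e by (simp_all add: the_inv_into_f_f)
  have "(transpose_mat (inter_col K D1 e j) * inter_col K D1 e l) $$ (0, 0)
      = (transpose_mat D1 * D1) $$ (a, c)"
    using D1 a c by (simp add: inter_col_def ia[unfolded a] ic[unfolded c])
  also have "\<dots> = (if a = c then 1 else 0)" using a c by (simp add: DD)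
  also have "a = c \<longleftrightarrow> j = l" using a c e by (auto dest: inj_onD)
  finally show ?thesis .
qed

lemma kronecker_square_orthogonal:
  assumes "real_orthogonal b D"
  shows "transpose_mat (D \<otimes>\<^sub>m D) * (D \<otimes>\<^sub>m D) = 1\<^sub>m (b * b)"
proof -
  have "D \<in> carrier_mat b b" "transpose_mat D * D = 1\<^sub>m b"
    using assms by (auto simp: real_orthogonal_def)
  then show ?thesis
    by (simp add: transpose_kronecker kronecker_mult[of _ b b _ b b _ b _ b] kronecker_one)
qed

text \<open>Transposition passes through the sum and the Kronecker product and reverses the inner
  matrix product. Every statement about synthesis thus reduces to one about analysis.\<close>

lemma synthesis_group_eq_transpose:
  assumes "D2 \<in> carrier_mat b b"
  shows "synthesis_group n b K D1 D2 e = transpose_mat (analysis_group n b K D1 D2 e)"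
proof -
  have "transpose_mat ((D2 \<otimes>\<^sub>m D2) * sel_mat n b j) =
      transpose_mat (sel_mat n b j) * transpose_mat (D2 \<otimes>\<^sub>m D2)" for j
    by (rule transpose_mult[OF kronecker_carrier[OF assms assms] sel_mat_carrier])
  moreover have "transpose_mat (analysis_group n b K D1 D2 e) = finsum_mat (n * n) (K * (b * b))
      (\<lambda>j. transpose_mat (inter_col K D1 e j \<otimes>\<^sub>m ((D2 \<otimes>\<^sub>m D2) * sel_mat n b j))) (group_set K e)"
    unfolding analysis_group_def
    by (rule transpose_finsum_mat) (auto simp: group_set_def analysis_summand_carrier assms)
  ultimately show ?thesis by (simp add: synthesis_group_def transpose_kronecker)
qed

lemma analysis_group_carrier:
  "D2 \<in> carrier_mat b b \<Longrightarrow> analysis_group n b K D1 D2 e \<in> carrier_mat (K * (b * b)) (n * n)"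
  unfolding analysis_group_def by (intro finsum_mat_carrier analysis_summand_carrier)

lemma analysis_group_gram:
  assumes D1: "real_orthogonal K D1" and D2: "real_orthogonal b D2" and e: "inj_on e {..<K}"
  shows "transpose_mat (analysis_group n b K D1 D2 e) * analysis_group n b K D1 D2 e =
    group_gram n b K e"
proof -
  let ?N = "n * n" and ?B = "b * b" and ?S = "group_set K e"
  define Q where "Q = D2 \<otimes>\<^sub>m D2"
  define d where "d = inter_col K D1 e"
  define P where "P = sel_mat n b"
  define X where "X j = d j \<otimes>\<^sub>m (Q * P j)" for j
  have D2c: "D2 \<in> carrier_mat b b" using D2 by (simp add: real_orthogonal_def)
  have Q: "Q \<in> carrier_mat ?B ?B" unfolding Q_def by (rule kronecker_carrier[OF D2c D2c])
  have P: "P j \<in> carrier_mat ?B ?N" for j by (simp add: P_def sel_mat_carrier)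
  have d: "d j \<in> carrier_mat K 1" for j unfolding d_def by (rule inter_col_carrier)
  have QP: "Q * P j \<in> carrier_mat ?B ?N" for j using Q P by (rule mult_carrier_mat)
  have X: "X j \<in> carrier_mat (K * ?B) ?N" for j
    unfolding X_def d_def Q_def P_def by (rule analysis_summand_carrier[OF D2c])
  have fin: "finite ?S" by (simp add: group_set_def)
  have A: "analysis_group n b K D1 D2 e = finsum_mat (K * ?B) ?N X ?S"
    by (simp add: analysis_group_def X_def[abs_def] d_def Q_def P_def)
  have PP: "transpose_mat (P j) * P l \<in> carrier_mat ?N ?N" for j l
    using P[of j] P[of l] by (intro mult_carrier_mat) auto
  \<comment> \<open>The intrablock transform cancels for every pair of blocks. Overlapping blocks
    may still give a nonzero product here, so the vanishing of cross terms has to come from the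
    factors \<open>d j\<close>.\<close>
  have QPQP: "transpose_mat (Q * P j) * (Q * P l) = transpose_mat (P j) * P l" for j l
  proof -
    have "transpose_mat (Q * P j) * (Q * P l) = transpose_mat (P j) * ((transpose_mat Q * Q) * P l)"
      using Q P[of j] P[of l] QP
      by (simp add: transpose_mult[OF Q P] assoc_mult_mat[of _ ?N ?B _ ?B _ ?N]
          assoc_mult_mat[of _ ?B ?B _ ?B _ ?N])
    then show ?thesis using kronecker_square_orthogonal[OF D2] P[of l] by (simp add: Q_def)
  qed
  have XX: "transpose_mat (X j) * X l = (if j = l then transpose_mat (P l) * P l else 0\<^sub>m ?N ?N)"
    if "j \<in> ?S" "l \<in> ?S" for j l
  proof -
    have dd: "transpose_mat (d j) * d l \<in> carrier_mat 1 1"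
      using d[of j] d[of l] by (intro mult_carrier_mat) auto
    have "transpose_mat (X j) * X l =
        (transpose_mat (d j) * d l) \<otimes>\<^sub>m (transpose_mat (Q * P j) * (Q * P l))"
      unfolding X_def transpose_kronecker
      by (rule kronecker_mult[of _ 1 K _ ?N ?B _ 1 _ ?N])
        (simp_all only: transpose_carrier_mat d QP)
    also have "\<dots> = (if j = l then 1 else 0) \<cdot>\<^sub>m (transpose_mat (P j) * P l)"
      by (simp only: kronecker_one_left[OF dd] QPQP
          inter_col_orthonormal[OF D1 e that, folded d_def])
    also have "\<dots> = (if j = l then transpose_mat (P l) * P l else 0\<^sub>m ?N ?N)"
      using PP[of j l] by (simp add: zero_smult_mat one_smult_mat)
    finally show ?thesis .
  qed
  \<comment> \<open>Only the right factor is expanded at first: for fixed \<open>j\<close> a single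
    term of the sum over \<open>l\<close> survives. The left factor is expanded afterwards.\<close>
  have XA: "transpose_mat (X j) * finsum_mat (K * ?B) ?N X ?S = transpose_mat (P j) * P j"
    if j: "j \<in> ?S" for j
  proof -
    have "transpose_mat (X j) * finsum_mat (K * ?B) ?N X ?S =
        finsum_mat ?N ?N (\<lambda>l. transpose_mat (X j) * X l) ?S"
      by (rule finsum_mat_mult_left[OF fin X]) (use X in simp)
    also have "\<dots> = finsum_mat ?N ?N
        (\<lambda>l. if j = l then transpose_mat (P l) * P l else 0\<^sub>m ?N ?N) ?S"
      by (rule finsum_mat_cong[OF fin XX[OF j]]) (use PP in auto)
    also have "\<dots> = transpose_mat (P j) * P j"
      by (rule finsum_mat_delta[OF fin j PP])
    finally show ?thesis .
  qed
  have Ac: "finsum_mat (K * ?B) ?N X ?S \<in> carrier_mat (K * ?B) ?N"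
    by (rule finsum_mat_carrier[OF X])
  have "transpose_mat (finsum_mat (K * ?B) ?N X ?S) * finsum_mat (K * ?B) ?N X ?S =
      finsum_mat ?N ?N (\<lambda>j. transpose_mat (X j) * finsum_mat (K * ?B) ?N X ?S) ?S"
    unfolding transpose_finsum_mat[OF fin X]
    by (rule finsum_mat_mult_right[OF fin _ Ac]) (use X in simp)
  also have "\<dots> = finsum_mat ?N ?N (\<lambda>j. transpose_mat (P j) * P j) ?S"
    by (rule finsum_mat_cong[OF fin XA PP])
  finally show ?thesis by (simp add: A group_gram_def P_def)
qed

section \<open>Diagonal form of the selection Gram matrices\<close>

text \<open>The number of positions in block \<open>j\<close> that hold pixel \<open>i\<close>. For
  a block inside the image this is the indicator of its set of pixels.\<close>

definition sel_count :: "nat \<Rightarrow> nat \<Rightarrow> nat \<Rightarrow> nat \<Rightarrow> real" where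
  "sel_count n b j i = (\<Sum>s<b * b. sel_mat n b j $$ (s, i))"

text \<open>A row of the selection matrix has at most one nonzero entry, so distinct columns are
  orthogonal. As the entries are 0 or 1, they equal their squares, and the diagonal consists of the
  column sums.\<close>

lemma sel_mat_gram:
  "transpose_mat (sel_mat n b j) * sel_mat n b j = mat_diag (n * n) (sel_count n b j)"
proof (rule eq_matI)
  let ?P = "sel_mat n b j"
  have T: "transpose_mat ?P \<in> carrier_mat (n * n) (b * b)" using sel_mat_carrier by simp
  fix i l assume "i < dim_row (mat_diag (n * n) (sel_count n b j))"
    "l < dim_col (mat_diag (n * n) (sel_count n b j))"
  then have il: "i < n * n" "l < n * n" by (auto simp: mat_diag_def)
  have "(transpose_mat ?P * ?P) $$ (i, l) = (\<Sum>s<b * b. if i = l then ?P $$ (s, l) else 0)"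
    unfolding index_mult_mat_sum[OF T sel_mat_carrier il]
    by (rule sum.cong) (use il in \<open>auto simp: sel_mat_def\<close>)
  then show "(transpose_mat ?P * ?P) $$ (i, l) = mat_diag (n * n) (sel_count n b j) $$ (i, l)"
    using il by (simp add: mat_diag_def sel_count_def)
qed (auto simp: mat_diag_def sel_mat_def)

lemma sel_count_nonneg: "i < n * n \<Longrightarrow> 0 \<le> sel_count n b j i"
  unfolding sel_count_def by (rule sum_nonneg) (simp add: sel_mat_def)

lemma sel_count_pos:
  assumes "i \<in> block_pixels n b j" "i < n * n"
  shows "0 < sel_count n b j i"
proof -
  obtain p q where pq: "i = (j div n + q) * n + (j mod n + p)" "p < b" "q < b"
    using assms(1) by (auto simp: block_pixels_def)
  \<comment> \<open>Blocks are vectorized columnwise, so the pixel at row offset \<open>p\<close>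
    and column offset \<open>q\<close> sits at position \<open>q * b + p\<close>.\<close>
  have s: "q * b + p < b * b" using pq by (intro mult_add_less_mult)
  then have "sel_mat n b j $$ (q * b + p, i) = 1"
    using pq assms(2) by (simp add: sel_mat_def)
  then show ?thesis unfolding sel_count_def
    by (intro sum_pos2[of _ "q * b + p"]) (use s assms(2) in \<open>auto simp: sel_mat_def\<close>)
qed

lemma group_gram_diag:
  "group_gram n b K e = mat_diag (n * n) (\<lambda>i. \<Sum>j\<in>group_set K e. sel_count n b j i)"
  unfolding group_gram_def sel_mat_gram by (rule finsum_mat_diag) (simp add: group_set_def)

section \<open>Weighted sums over all groups\<close>

lemma finsum_group_gram_diag:
  fixes R :: nat
  shows "finsum_mat (n * n) (n * n) (\<lambda>r. g r \<cdot>\<^sub>m group_gram n b K (J r)) {..<R} =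
    mat_diag (n * n) (\<lambda>i. \<Sum>r<R. g r * (\<Sum>j\<in>group_set K (J r). sel_count n b j i))"
  unfolding group_gram_diag smult_mat_diag by (rule finsum_mat_diag) simp

text \<open>The covering assumption supplies a group and a block of it containing pixel
  \<open>i\<close>; that term is positive and no other is negative. The weights are arbitrary
  because the lemma is applied with 1, \<open>g\<close> and the squares of \<open>g\<close>.\<close>

lemma weighted_count_pos:
  assumes J: "grouping n b K R J" and g: "\<And>r. r < R \<Longrightarrow> 0 < g r" and i: "i < n * n"
  shows "0 < (\<Sum>r<R. g r * (\<Sum>j\<in>group_set K (J r). sel_count n b j i))"
proof -
  obtain r j where r: "r < R" and j: "j \<in> group_set K (J r)" "i \<in> block_pixels n b j"
    using J i unfolding grouping_def by blast
  have nonneg: "0 \<le> (\<Sum>j\<in>group_set K (J r). sel_count n b j i)" for r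
    by (intro sum_nonneg sel_count_nonneg i)
  have "0 < (\<Sum>j\<in>group_set K (J r). sel_count n b j i)"
    by (rule sum_pos2[of _ j])
      (use j i in \<open>auto simp: group_set_def sel_count_pos sel_count_nonneg\<close>)
  then show ?thesis
    by (intro sum_pos2[of _ r]) (use r g nonneg in \<open>auto simp: less_imp_le\<close>)
qed

section \<open>The stacked analysis and synthesis matrices\<close>

theorem proposition1:
  fixes n b K R :: nat
    and D1 D2 :: "real mat"
    and J :: "nat \<Rightarrow> nat \<Rightarrow> nat"
    and g :: "nat \<Rightarrow> real"
  assumes "grouping n b K R J"
    and "real_orthogonal K D1"
    and "real_orthogonal b D2"
    and "\<And>r. r < R \<Longrightarrow> g r > 0"
  shows "transpose_mat (analysis n b K R D1 D2 J) * analysis n b K R D1 D2 J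
           = finsum_mat (n * n) (n * n) (\<lambda>r. group_gram n b K (J r)) {..<R}
         \<and> pos_definite (n * n) (finsum_mat (n * n) (n * n) (\<lambda>r. group_gram n b K (J r)) {..<R})
         \<and> synthesis n b K R D1 D2 J g * transpose_mat (synthesis n b K R D1 D2 J g)
           = finsum_mat (n * n) (n * n) (\<lambda>r. (g r)\<^sup>2 \<cdot>\<^sub>m group_gram n b K (J r)) {..<R}
             * (inv_mat (n * n) (weight_mat n b K R J g) ^\<^sub>m 2)
         \<and> pos_definite (n * n)
           (finsum_mat (n * n) (n * n) (\<lambda>r. (g r)\<^sup>2 \<cdot>\<^sub>m group_gram n b K (J r)) {..<R}
             * (inv_mat (n * n) (weight_mat n b K R J g) ^\<^sub>m 2))
         \<and> synthesis n b K R D1 D2 J g * analysis n b K R D1 D2 J = 1\<^sub>m (n * n)"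
proof -
  let ?N = "n * n" and ?w = "K * (b * b)"
  define A where "A r = analysis_group n b K D1 D2 (J r)" for r
  define G where "G r = group_gram n b K (J r)" for r
  \<comment> \<open>\<open>c r\<close> is the diagonal of the Gram matrix of group \<open>r\<close>,
    and \<open>W\<close> below is the diagonal of \<open>weight_mat\<close>.\<close>
  define c where "c r i = (\<Sum>j\<in>group_set K (J r). sel_count n b j i)" for r i
  define W where "W i = (\<Sum>r<R. g r * c r i)" for i
  have D2: "D2 \<in> carrier_mat b b" using assms(3) by (simp add: real_orthogonal_def)
  have A: "A r \<in> carrier_mat ?w ?N" for r
    unfolding A_def by (rule analysis_group_carrier[OF D2])
  have AA: "transpose_mat (A r) * A r = G r" if "r < R" for r
    unfolding A_def G_def by (rule analysis_group_gram[OF assms(2,3)])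
      (use assms(1) that in \<open>auto simp: grouping_def\<close>)
  have G: "G r \<in> carrier_mat ?N ?N" for r
    unfolding G_def group_gram_diag by simp
  have sumG: "finsum_mat ?N ?N (\<lambda>r. h r \<cdot>\<^sub>m G r) {..<R} = mat_diag ?N (\<lambda>i. \<Sum>r<R. h r * c r i)" for h
    unfolding G_def c_def by (rule finsum_group_gram_diag)
  have sumG1: "finsum_mat ?N ?N G {..<R} = mat_diag ?N (\<lambda>i. \<Sum>r<R. c r i)"
    unfolding G_def[abs_def] group_gram_diag c_def by (rule finsum_mat_diag) simp
  have pos: "0 < (\<Sum>r<R. h r * c r i)" if "\<And>r. r < R \<Longrightarrow> 0 < h r" "i < ?N" for h i
    unfolding c_def using assms(1) that by (rule weighted_count_pos)
  have pos1: "0 < (\<Sum>r<R. c r i)" if "i < ?N" for i using pos[of "\<lambda>_. 1" i] that by simp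
  have W: "0 < W i" if "i < ?N" for i unfolding W_def by (rule pos[OF assms(4) that])
  have inv: "inv_mat ?N (weight_mat n b K R J g) = mat_diag ?N (\<lambda>i. 1 / W i)"
    unfolding weight_mat_def G_def[symmetric] sumG W_def[symmetric]
    by (rule inv_mat_diag) (use W in force)
  \<comment> \<open>The analysis matrix is the transpose of \<open>U\<close>, and the synthesis
    matrix is the inverse weight matrix times \<open>V\<close>. The three products to compute reduce
    to \<open>U * transpose_mat U\<close>, \<open>V * transpose_mat U\<close> and
    \<open>V * transpose_mat V\<close>.\<close>
  define U where "U = block_row ?N ?w R (\<lambda>r. transpose_mat (A r))"
  define V where "V = block_row ?N ?w R (\<lambda>r. g r \<cdot>\<^sub>m transpose_mat (A r))"
  have U: "U \<in> carrier_mat ?N (R * ?w)" and V: "V \<in> carrier_mat ?N (R * ?w)"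
    by (simp_all add: U_def V_def block_row_carrier)
  have Phi: "analysis n b K R D1 D2 J = transpose_mat U"
    by (simp add: analysis_def U_def A_def)
  have Psi: "synthesis n b K R D1 D2 J g = mat_diag ?N (\<lambda>i. 1 / W i) * V"
    by (simp add: synthesis_def inv V_def A_def synthesis_group_eq_transpose[OF D2])
  have T: "transpose_mat (A r) \<in> carrier_mat ?N ?w" and gT: "g r \<cdot>\<^sub>m transpose_mat (A r) \<in> carrier_mat ?N ?w"
    for r using A by simp_all
  have UU: "U * transpose_mat U = finsum_mat ?N ?N G {..<R}"
    unfolding U_def block_row_mult_transpose[OF T T] by (rule finsum_mat_cong; simp add: AA G)
  \<comment> \<open>Each weight enters once here, which gives exactly the weight matrix; in the
    product of \<open>V\<close> with its own transpose it enters twice, hence the squares.\<close>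
  have VU: "V * transpose_mat U = mat_diag ?N W"
    unfolding U_def V_def W_def sumG[symmetric] block_row_mult_transpose[OF gT T]
    by (rule finsum_mat_cong; use A in \<open>simp add: mult_smult_assoc_mat[of _ ?N ?w _ ?N] AA G\<close>)
  have VV: "V * transpose_mat V = mat_diag ?N (\<lambda>i. \<Sum>r<R. (g r)\<^sup>2 * c r i)"
    unfolding V_def sumG[symmetric] block_row_mult_transpose[OF gT gT]
  proof (rule finsum_mat_cong)
    fix r assume "r \<in> {..<R}"
    then show "g r \<cdot>\<^sub>m transpose_mat (A r) * transpose_mat (g r \<cdot>\<^sub>m transpose_mat (A r)) = (g r)\<^sup>2 \<cdot>\<^sub>m G r"
      using A[of r] AA[of r]
      by (simp add: transpose_smult_mat mult_smult_assoc_mat[of _ ?N ?w _ ?N]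
          mult_smult_distrib[of _ ?N ?w _ ?N] smult_smult_mat power2_eq_square)
  qed (simp_all add: G)
  have sq: "mat_diag ?N (\<lambda>i. \<Sum>r<R. (g r)\<^sup>2 * c r i) * (mat_diag ?N (\<lambda>i. 1 / W i) ^\<^sub>m 2) =
      mat_diag ?N (\<lambda>i. (\<Sum>r<R. (g r)\<^sup>2 * c r i) * (1 / W i * (1 / W i)))"
    by (simp add: numeral_2_eq_2)
  \<comment> \<open>The inverse weight matrix is symmetric and so appears on both sides of
    \<open>V * transpose_mat V\<close>. All three factors are diagonal and commute, so both copies
    can be gathered on the right as the inverse square in the claim; comparing diagonals with
    \<open>sq\<close> does this.\<close>
  have "mat_diag ?N (\<lambda>i. 1 / W i) * V * transpose_mat (mat_diag ?N (\<lambda>i. 1 / W i) * V) =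
      mat_diag ?N (\<lambda>i. 1 / W i) * (V * transpose_mat V) * mat_diag ?N (\<lambda>i. 1 / W i)"
    using V by (simp add: transpose_mult[OF mat_diag_dim V] transpose_mat_diag
        assoc_mult_mat[of _ ?N "R * ?w" _ ?N _ ?N] assoc_mult_mat[of _ ?N ?N _ "R * ?w" _ ?N]
        assoc_mult_mat[of _ ?N ?N _ ?N _ ?N])
  also have "\<dots> = mat_diag ?N (\<lambda>i. (\<Sum>r<R. (g r)\<^sup>2 * c r i) * (1 / W i * (1 / W i)))"
    by (simp add: VV)
  finally have PsiPsi: "mat_diag ?N (\<lambda>i. 1 / W i) * V * transpose_mat (mat_diag ?N (\<lambda>i. 1 / W i) * V) =
      mat_diag ?N (\<lambda>i. (\<Sum>r<R. (g r)\<^sup>2 * c r i) * (1 / W i * (1 / W i)))" .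
  have PsiPhi: "mat_diag ?N (\<lambda>i. 1 / W i) * V * transpose_mat U = 1\<^sub>m ?N"
  proof -
    have "mat_diag ?N (\<lambda>i. 1 / W i) * V * transpose_mat U = mat_diag ?N (\<lambda>i. 1 / W i) * mat_diag ?N W"
      using U V by (simp add: assoc_mult_mat[of _ ?N ?N _ "R * ?w" _ ?N] VU del: mat_diag_diag)
    also have "\<dots> = 1\<^sub>m ?N"
      unfolding mat_diag_diag mat_diag_one[symmetric]
      by (rule mat_diag_cong) (use W in force)
    finally show ?thesis .
  qed
  have pos2: "0 < (\<Sum>r<R. (g r)\<^sup>2 * c r i) * (1 / W i * (1 / W i))" if "i < ?N" for i
    by (intro mult_pos_pos divide_pos_pos pos W that zero_less_power assms(4)) simp_all
  show ?thesis
    unfolding Phi Psi inv G_def[symmetric] sumG sq PsiPsi PsiPhi transpose_transpose UU sumG1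
    by (intro conjI refl pos_definite_mat_diag pos1 pos2)
qed

end
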